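(* Assume that $\mathbf{X}'\mathbf{X}/n\to\boldsymbol{\Sigma}$ as $n\to\infty$, where $\boldsymbol{\Sigma}$ is a positive definite matrix. Then the objective functions $$\psi_n(\mathcal{A})=\big(1+|\mathcal{A}|\log(n)/n\big)\big\|\mathbf{y}-\mathbf{X}_{\mathcal{A}}\hat{\boldsymbol{\beta}}_{\mathcal{A}}\big\|^2,\quad\mathcal{A}\in\mathfrak{D},$$ strongly separate $\mathfrak{A}=\{\mathcal{A}_0\}$ from $\mathfrak{B}=\mathfrak{D}\setminus\mathfrak{A}$; that is, as $n\to\infty$, $$P\left(\psi_n(\mathcal{A}_0)<\inf_{\mathcal{A}\in\mathfrak{B}}\psi_n(\mathcal{A})\right)\to1.$$
   Context: Linear regression model $\mathbf{y}=\mathbf{X}\boldsymbol{\beta}+\boldsymbol{\varepsilon}$ without intercept, where $\mathbf{X}=(x_{ij})$ is the (nonrandom) $n\times p$ regression matrix, $\mathbf{y}\in\mathbb{R}^n$ is the response vector, $\boldsymbol{\beta}=(\beta_1,\ldots,\beta_p)'$ is the true coefficient vector, and $\boldsymbol{\varepsilon}=(\varepsilon_1,\ldots,\varepsilon_n)'$ is a vector of i.i.d. random errors with zero mean and finite variance $\sigma^2$. Here $p$ and $\boldsymbol{\beta}$ are fixed (do not depend on $n$). $\mathbb{Z}_p=\{1,\ldots,p\}$; the decision space $\mathfrak{D}$ is the power set of $\mathbb{Z}_p$. The true submodel is $\mathcal{A}_0=\{j\in\mathbb{Z}_p:\beta_j\neq0\}$. For $\mathcal{A}\subset\mathbb{Z}_p$,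 $|\mathcal{A}|$ is its cardinality, $\mathbf{X}_{\mathcal{A}}$ is the submatrix of $\mathbf{X}$ consisting of the columns with indices in $\mathcal{A}$, and $\hat{\boldsymbol{\beta}}_{\mathcal{A}}=(\mathbf{X}_{\mathcal{A}}'\mathbf{X}_{\mathcal{A}})^{-1}\mathbf{X}_{\mathcal{A}}'\mathbf{y}$ is the least squares estimator under the submodel $\mathcal{A}$.
   Formalization: The error variance σ² is assumed to be strictly positive; for σ² = 0 the claim fails, since every submodel containing the true one then has objective value 0 for large n and the strict inequality cannot hold (e.g. p = 1, β = 0). *)

theory Defs
  imports
    "HOL-Probability.Probability"
    "Jordan_Normal_Form.DL_Submatrix"
    "Jordan_Normal_Form.Gauss_Jordan_Elimination"
begin

no_notation Finite_Cartesian_Product.vec_nth (infixl \<open>$\<close> 90)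
no_notation Inner_Product.real_inner_class.inner (infixl \<open>\<bullet>\<close> 70)

text \<open>Matrices have varying dimensions and are therefore taken from the Jordan-Normal-Form
  library. Rows and columns are numbered from 0, so the index set $\{1,\ldots,p\}$ of the
  coefficients is rendered as $\{0,\ldots,p-1\}$, and the errors
  $\varepsilon_1,\ldots,\varepsilon_n$ are \<open>\<epsilon> 0, \<dots>, \<epsilon> (n - 1)\<close>.\<close>

definition decision_space :: "nat \<Rightarrow> nat set set" where
  "decision_space p = Pow {..<p}"

definition true_submodel :: "real vec \<Rightarrow> nat set" where
  "true_submodel \<beta> = {j. j < dim_vec \<beta> \<and> \<beta> $ j \<noteq> 0}"

definition positive_definite :: "nat \<Rightarrow> real mat \<Rightarrow> bool" where
  "positive_definite p S \<longleftrightarrow> S \<in> carrier_mat p p \<and> transpose_mat S = S \<and>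
     (\<forall>v \<in> carrier_vec p. v \<noteq> 0\<^sub>v p \<longrightarrow> v \<bullet> (S *\<^sub>v v) > 0)"

definition mat_tendsto :: "nat \<Rightarrow> nat \<Rightarrow> (nat \<Rightarrow> real mat) \<Rightarrow> real mat \<Rightarrow> bool" where
  "mat_tendsto k l S T \<longleftrightarrow> (\<forall>i<k. \<forall>j<l. (\<lambda>n. S n $$ (i, j)) \<longlonglongrightarrow> T $$ (i, j))"

definition response :: "real mat \<Rightarrow> real vec \<Rightarrow> (nat \<Rightarrow> real) \<Rightarrow> real vec" where
  "response X \<beta> e = X *\<^sub>v \<beta> + vec (dim_row X) e"

definition submodel_mat :: "real mat \<Rightarrow> nat set \<Rightarrow> real mat" where
  "submodel_mat X A = submatrix X UNIV A"

text \<open>If the Gram matrix is singular, \<open>mat_inverse\<close> returns \<open>None\<close> and the estimator is an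
  unspecified vector. For \<open>A = {}\<close> the Gram matrix is the invertible 0 by 0 matrix and the
  fitted vector is 0.\<close>

definition ls_estimator :: "real mat \<Rightarrow> nat set \<Rightarrow> real vec \<Rightarrow> real vec" where
  "ls_estimator X A y =
     (let XA = submodel_mat X A
      in the (mat_inverse (transpose_mat XA * XA)) *\<^sub>v (transpose_mat XA *\<^sub>v y))"

definition sq_euclidean_norm :: "real vec \<Rightarrow> real" where
  "sq_euclidean_norm v = (\<Sum>i<dim_vec v. (v $ i)\<^sup>2)"

text \<open>The sample size $n$ is the number of rows of \<open>X\<close>.\<close>

definition objective :: "real mat \<Rightarrow> real vec \<Rightarrow> nat set \<Rightarrow> real" where
  "objective X y A =
     (1 + real (card A) * ln (real (dim_row X)) / real (dim_row X)) *
     sq_euclidean_norm (y - submodel_mat X A *\<^sub>v ls_estimator X A y)"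

end

theory Submission
  imports Defs "Jordan_Normal_Form.Determinant" "HOL-Real_Asymp.Real_Asymp"
begin

text \<open>
  Write \<open>e\<close> for the error vector, \<open>R A\<close> for the residual sum of squares of the submodel \<open>A\<close>, and
  \<open>W = \<parallel>X' e\<parallel>\<^sup>2 / n\<close>. Since \<open>X' X / n\<close> converges to a positive definite matrix, there is \<open>l > 0\<close> with
  \<open>\<parallel>X v\<parallel>\<^sup>2 \<ge> n l \<parallel>v\<parallel>\<^sup>2\<close> for all \<open>v\<close> and all large \<open>n\<close> (\<open>eventually_coercive\<close>). The fit of \<open>A\<close> has the
  form \<open>X c\<close> with \<open>c\<close> supported on \<open>A\<close>, hence with \<open>d = \<beta> - c\<close>
  \[ R(A) = \|X d + e\|^2 \ge \|e\|^2 + n l \|d\|^2 + 2 \langle d, X' e \rangle . \]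
  Completing the square in \<open>d\<close> gives \<open>R A \<ge> \<parallel>e\<parallel>\<^sup>2 - 2 W / l\<close> for every \<open>A\<close>, with an additional term
  \<open>n l \<delta> / 2\<close> on the right if \<open>A\<close> omits a nonzero coefficient (whose square is at least \<open>\<delta>\<close>); and
  \<open>R A\<^sub>0 \<le> \<parallel>e\<parallel>\<^sup>2\<close> for the true submodel \<open>A\<^sub>0\<close>, because least squares does at least as well as \<open>\<beta>\<close>
  (\<open>residual_ss_lower\<close>, \<open>residual_ss_upper\<close>).

  What remains is a comparison of orders of magnitude. Put \<open>s = sqrt (ln n)\<close>. With probability
  tending to 1, \<open>W \<le> s\<close>, \<open>\<parallel>e\<parallel>\<^sup>2 \<le> n s\<close> and \<open>\<parallel>e\<parallel>\<^sup>2 \<ge> c n\<close> for a constant \<open>c > 0\<close>: the two upper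
  bounds follow from Markov's inequality, because \<open>W\<close> and \<open>\<parallel>e\<parallel>\<^sup>2 / n\<close> have bounded expectation, and
  the lower bound from Hoeffding's inequality for the truncated squares \<open>min 1 (\<epsilon> i)\<^sup>2\<close>. On this event
  (\<open>objective_less_objective\<close>):

  \<^item> If \<open>A\<close> properly contains \<open>A\<^sub>0\<close>, its penalty factor is larger by at least \<open>ln n / n\<close>, which
    multiplied by \<open>\<parallel>e\<parallel>\<^sup>2\<close> contributes at least \<open>c ln n\<close>, while its residual sum of squares falls below
    \<open>\<parallel>e\<parallel>\<^sup>2\<close> by at most \<open>2 s / l\<close>, which is of smaller order.
  \<^item> If \<open>A\<close> omits an element of \<open>A\<^sub>0\<close>, its residual sum of squares exceeds \<open>\<parallel>e\<parallel>\<^sup>2\<close> by an amount of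
    order \<open>n\<close>, while the penalty raises the objective of \<open>A\<^sub>0\<close> above \<open>\<parallel>e\<parallel>\<^sup>2\<close> by at most \<open>p s ln n\<close>.

  There are finitely many submodels, and the three bounds do not depend on \<open>A\<close>, so the comparison holds
  for all of them at once.
\<close>

no_notation Inner_Product.real_inner_class.inner (infixl \<open>\<bullet>\<close> 70)

section \<open>Least squares under a submodel\<close>

lemma sq_euclidean_norm_scalar_prod: "sq_euclidean_norm v = v \<bullet> v"
  by (simp add: sq_euclidean_norm_def scalar_prod_def power2_eq_square atLeast0LessThan)

lemma sq_euclidean_norm_nonneg: "0 \<le> sq_euclidean_norm v"
  by (simp add: sq_euclidean_norm_def sum_nonneg)

lemma sq_euclidean_norm_zero: "sq_euclidean_norm (0\<^sub>v n) = 0"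
  by (simp add: sq_euclidean_norm_def)

lemma sq_euclidean_norm_add:
  assumes "a \<in> carrier_vec n" "b \<in> carrier_vec n"
  shows "sq_euclidean_norm (a + b) = sq_euclidean_norm a + 2 * (a \<bullet> b) + sq_euclidean_norm b"
  using assms
  by (simp add: sq_euclidean_norm_scalar_prod scalar_prod_add_distrib[of _ n]
      add_scalar_prod_distrib[of _ n] comm_scalar_prod[of b n a])

lemma sq_euclidean_norm_mult_mat_vec:
  assumes "X \<in> carrier_mat n p" "d \<in> carrier_vec p"
  shows "sq_euclidean_norm (X *\<^sub>v d) = d \<bullet> ((transpose_mat X * X) *\<^sub>v d)"
proof -
  have "d \<bullet> ((transpose_mat X * X) *\<^sub>v d) = (transpose_mat X *\<^sub>v (X *\<^sub>v d)) \<bullet> d"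
    using assms by (subst comm_scalar_prod[of _ p]) (auto simp: assoc_mult_mat_vec[of _ p n _ p])
  also have "\<dots> = (X *\<^sub>v d) \<bullet> (X *\<^sub>v d)"
    using assms by (intro transpose_vec_mult_scalar[of X n p]) auto
  finally show ?thesis by (simp add: sq_euclidean_norm_scalar_prod)
qed

lemma mat_inverse_if_trivial_kernel:
  fixes G :: "real mat"
  assumes G: "G \<in> carrier_mat k k"
    and ker: "\<And>v. v \<in> carrier_vec k \<Longrightarrow> G *\<^sub>v v = 0\<^sub>v k \<Longrightarrow> v = 0\<^sub>v k"
  obtains H where "mat_inverse G = Some H" "H \<in> carrier_mat k k" "G * H = 1\<^sub>m k"
proof -
  have "det G \<noteq> 0"
    using det_0_iff_vec_prod_zero_field[OF G] ker by blast
  hence "G \<in> Units (ring_mat TYPE(real) k ())"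
    by (rule det_non_zero_imp_unit[OF G])
  hence "mat_inverse G \<noteq> None"
    using mat_inverse(1)[OF G, of "()"] by auto
  then obtain H where "mat_inverse G = Some H" by auto
  with mat_inverse(2)[OF G this] that show ?thesis by auto
qed

lemma carrier_submodel_mat:
  assumes "X \<in> carrier_mat n p" "A \<subseteq> {..<p}"
  shows "submodel_mat X A \<in> carrier_mat n (card A)"
proof -
  have "{j. j < p \<and> j \<in> A} = A" using assms by auto
  thus ?thesis using assms by (auto simp: submodel_mat_def submatrix_def)
qed

lemma bij_betw_pick:
  assumes "finite A"
  shows "bij_betw (pick A) {..<card A} A"
proof -
  have inj: "inj_on (pick A) {..<card A}"
    by (metis (no_types, lifting) inj_onI lessThan_iff linorder_neqE_nat nat_less_le pick_mono_le)
  moreover have "pick A ` {..<card A} \<subseteq> A"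
    using pick_in_set_le by auto
  ultimately show ?thesis
    using assms by (metis bij_betw_def card_image card_lessThan card_subset_eq)
qed

text \<open>
  Fitting with the columns in \<open>A\<close> is fitting with all columns and coefficients that vanish outside \<open>A\<close>.
  This puts all submodels into the one coefficient space of dimension \<open>p\<close>, where \<open>\<beta>\<close> lives.
\<close>

lemma submodel_mat_mult_restriction:
  assumes X: "X \<in> carrier_mat n p" and A: "A \<subseteq> {..<p}"
    and c: "c \<in> carrier_vec p" "\<And>j. j < p \<Longrightarrow> j \<notin> A \<Longrightarrow> c $ j = 0"
  shows "submodel_mat X A *\<^sub>v vec (card A) (\<lambda>k. c $ pick A k) = X *\<^sub>v c"
proof (rule eq_vecI)
  have fin: "finite A" using A finite_subset by blast
  have eq: "{j. j < p \<and> j \<in> A} = A" using A by auto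
  fix i assume "i < dim_vec (X *\<^sub>v c)"
  hence i: "i < n" using X by auto
  have "(submodel_mat X A *\<^sub>v vec (card A) (\<lambda>k. c $ pick A k)) $ i
      = (\<Sum>k<card A. X $$ (i, pick A k) * c $ pick A k)"
    using X A i carrier_submodel_mat[OF X A]
    by (auto simp: scalar_prod_def atLeast0LessThan submodel_mat_def submatrix_def eq pick_UNIV
        intro!: sum.cong)
  also have "\<dots> = (\<Sum>j\<in>A. X $$ (i, j) * c $ j)"
    by (rule sum.reindex_bij_betw[OF bij_betw_pick[OF fin]])
  also have "\<dots> = (\<Sum>j<p. X $$ (i, j) * c $ j)"
    using A c by (intro sum.mono_neutral_left) auto
  also have "\<dots> = (X *\<^sub>v c) $ i"
    using X c i by (auto simp: scalar_prod_def atLeast0LessThan intro!: sum.cong)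
  finally show "(submodel_mat X A *\<^sub>v vec (card A) (\<lambda>k. c $ pick A k)) $ i = (X *\<^sub>v c) $ i" .
qed (use X carrier_submodel_mat[OF X A] in auto)

lemma extend_submodel_coefficients:
  fixes b :: "real vec"
  assumes A: "A \<subseteq> {..<p}" and b: "b \<in> carrier_vec (card A)"
  obtains c where "c \<in> carrier_vec p" "\<And>j. j < p \<Longrightarrow> j \<notin> A \<Longrightarrow> c $ j = 0"
    "vec (card A) (\<lambda>k. c $ pick A k) = b"
proof
  have fin: "finite A" using A finite_subset by blast
  note bij = bij_betw_pick[OF fin]
  let ?c = "vec p (\<lambda>j. if j \<in> A then b $ inv_into {..<card A} (pick A) j else 0)"
  show "vec (card A) (\<lambda>k. ?c $ pick A k) = b"
  proof (rule eq_vecI)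
    fix k assume "k < dim_vec b"
    hence k: "k < card A" using b by auto
    hence "pick A k \<in> A" using pick_in_set_le by auto
    moreover hence "pick A k < p" using A by auto
    moreover have "inv_into {..<card A} (pick A) (pick A k) = k"
      using bij k by (simp add: bij_betw_def)
    ultimately show "vec (card A) (\<lambda>k. ?c $ pick A k) $ k = b $ k" using k by simp
  qed (use b in auto)
qed auto

definition residual_ss :: "real mat \<Rightarrow> nat set \<Rightarrow> real vec \<Rightarrow> real" where
  "residual_ss X A y = sq_euclidean_norm (y - submodel_mat X A *\<^sub>v ls_estimator X A y)"

text \<open>
  If \<open>X\<close> has independent columns, so has each of its submatrices, and \<open>Z' Z v = 0\<close> forces \<open>\<parallel>Z v\<parallel>\<^sup>2 = 0\<close>.
  Hence the Gram matrix of the submodel is invertible, and the estimator solves the normal equations.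
\<close>

lemma ls_normal_equations:
  assumes X: "X \<in> carrier_mat n p" and A: "A \<subseteq> {..<p}" and y: "y \<in> carrier_vec n"
    and inj: "\<And>v. v \<in> carrier_vec p \<Longrightarrow> X *\<^sub>v v = 0\<^sub>v n \<Longrightarrow> v = 0\<^sub>v p"
  shows "ls_estimator X A y \<in> carrier_vec (card A)"
    and "transpose_mat (submodel_mat X A) *\<^sub>v (y - submodel_mat X A *\<^sub>v ls_estimator X A y)
           = 0\<^sub>v (card A)"
proof -
  let ?k = "card A"
  define Z where "Z = submodel_mat X A"
  have Z: "Z \<in> carrier_mat n ?k" using carrier_submodel_mat[OF X A] by (simp add: Z_def)
  let ?G = "transpose_mat Z * Z"
  have G: "?G \<in> carrier_mat ?k ?k" using Z by auto
  have ker: "b = 0\<^sub>v ?k" if b: "b \<in> carrier_vec ?k" and 0: "?G *\<^sub>v b = 0\<^sub>v ?k" for b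
  proof -
    obtain c where c: "c \<in> carrier_vec p" "\<And>j. j < p \<Longrightarrow> j \<notin> A \<Longrightarrow> c $ j = 0"
      "vec ?k (\<lambda>k. c $ pick A k) = b"
      using extend_submodel_coefficients[OF A b] by blast
    have Zb: "Z *\<^sub>v b = X *\<^sub>v c"
      using submodel_mat_mult_restriction[OF X A c(1,2)] c(3) by (simp add: Z_def)
    have "sq_euclidean_norm (X *\<^sub>v c) = 0"
      using sq_euclidean_norm_mult_mat_vec[OF Z b] 0 b by (simp add: Zb)
    hence "X *\<^sub>v c = 0\<^sub>v n"
      using X by (intro eq_vecI) (auto simp: sq_euclidean_norm_def sum_nonneg_eq_0_iff)
    hence "c = 0\<^sub>v p" using inj c(1) by blast
    show ?thesis
    proof (rule eq_vecI)
      fix k assume "k < dim_vec (0\<^sub>v ?k)"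
      hence k: "k < ?k" by simp
      hence "pick A k < p" using pick_in_set_le A by blast
      thus "b $ k = 0\<^sub>v ?k $ k" using k \<open>c = 0\<^sub>v p\<close> by (simp add: c(3)[symmetric])
    qed (use b in auto)
  qed
  obtain H where H: "mat_inverse ?G = Some H" "H \<in> carrier_mat ?k ?k" "?G * H = 1\<^sub>m ?k"
    using mat_inverse_if_trivial_kernel[OF G ker] by blast
  define u where "u = transpose_mat Z *\<^sub>v y"
  have u: "u \<in> carrier_vec ?k" using Z y unfolding u_def by (intro mult_mat_vec_carrier[of _ _ n]) auto
  have ls: "ls_estimator X A y = H *\<^sub>v u"
    by (simp add: ls_estimator_def Z_def[symmetric] H(1) u_def Let_def)
  show "ls_estimator X A y \<in> carrier_vec ?k"
    using H u by (auto simp: ls)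
  have "transpose_mat Z *\<^sub>v (Z *\<^sub>v (H *\<^sub>v u)) = (?G * H) *\<^sub>v u"
    using Z H(2) u by (simp add: assoc_mult_mat_vec[of _ ?k ?k _ ?k] assoc_mult_mat_vec[of _ ?k n _ ?k])
  also have "\<dots> = u" using H u by simp
  finally have "transpose_mat Z *\<^sub>v (y - Z *\<^sub>v (H *\<^sub>v u)) = u - u"
    using Z H(2) u y by (subst mult_minus_distrib_mat_vec[of _ ?k n]) (auto simp: u_def)
  thus "transpose_mat (submodel_mat X A) *\<^sub>v (y - submodel_mat X A *\<^sub>v ls_estimator X A y) = 0\<^sub>v ?k"
    using u by (simp add: ls Z_def)
qed

text \<open>
  The residual is orthogonal to every fitted vector, so any other choice of coefficients adds a square
  by Pythagoras.
\<close>

lemma residual_ss_minimal: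
  assumes X: "X \<in> carrier_mat n p" and A: "A \<subseteq> {..<p}" and y: "y \<in> carrier_vec n"
    and inj: "\<And>v. v \<in> carrier_vec p \<Longrightarrow> X *\<^sub>v v = 0\<^sub>v n \<Longrightarrow> v = 0\<^sub>v p"
    and c: "c \<in> carrier_vec p" "\<And>j. j < p \<Longrightarrow> j \<notin> A \<Longrightarrow> c $ j = 0"
  shows "residual_ss X A y \<le> sq_euclidean_norm (y - X *\<^sub>v c)"
proof -
  let ?k = "card A"
  define Z where "Z = submodel_mat X A"
  have Z: "Z \<in> carrier_mat n ?k" using carrier_submodel_mat[OF X A] by (simp add: Z_def)
  define b where "b = ls_estimator X A y"
  define b' where "b' = vec ?k (\<lambda>k. c $ pick A k)"
  note ne = ls_normal_equations[OF X A y inj, folded Z_def b_def]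
  have b: "b \<in> carrier_vec ?k" "b' \<in> carrier_vec ?k" using ne by (auto simp: b'_def)
  have Xc: "X *\<^sub>v c = Z *\<^sub>v b'"
    using submodel_mat_mult_restriction[OF X A c] by (simp add: Z_def b'_def)
  let ?r = "y - Z *\<^sub>v b"
  have r: "?r \<in> carrier_vec n" using y Z b by auto
  have "y - X *\<^sub>v c = ?r + Z *\<^sub>v (b - b')"
    using y Z b by (auto simp: Xc mult_minus_distrib_mat_vec[of _ n ?k])
  moreover have "?r \<bullet> (Z *\<^sub>v (b - b')) = 0"
  proof -
    have "?r \<bullet> (Z *\<^sub>v (b - b')) = (transpose_mat Z *\<^sub>v ?r) \<bullet> (b - b')"
      using Z r b by (intro transpose_vec_mult_scalar[symmetric, of Z n ?k]) auto
    also have "\<dots> = 0\<^sub>v ?k \<bullet> (b - b')" by (simp only: ne(2))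
    also have "\<dots> = 0" using b by (intro scalar_prod_left_zero) auto
    finally show ?thesis .
  qed
  moreover have "Z *\<^sub>v (b - b') \<in> carrier_vec n"
    using Z b by (intro mult_mat_vec_carrier[of _ n ?k]) auto
  ultimately have "sq_euclidean_norm (y - X *\<^sub>v c)
      = sq_euclidean_norm ?r + sq_euclidean_norm (Z *\<^sub>v (b - b'))"
    using r by (simp add: sq_euclidean_norm_add[of _ n])
  thus ?thesis
    using sq_euclidean_norm_nonneg[of "Z *\<^sub>v (b - b')"]
    by (simp add: residual_ss_def Z_def b_def)
qed

lemma residual_ss_eq_extended:
  assumes X: "X \<in> carrier_mat n p" and A: "A \<subseteq> {..<p}" and y: "y \<in> carrier_vec n"
    and inj: "\<And>v. v \<in> carrier_vec p \<Longrightarrow> X *\<^sub>v v = 0\<^sub>v n \<Longrightarrow> v = 0\<^sub>v p"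
  obtains c where "c \<in> carrier_vec p" "\<And>j. j < p \<Longrightarrow> j \<notin> A \<Longrightarrow> c $ j = 0"
    "residual_ss X A y = sq_euclidean_norm (y - X *\<^sub>v c)"
proof -
  obtain c where c: "c \<in> carrier_vec p" "\<And>j. j < p \<Longrightarrow> j \<notin> A \<Longrightarrow> c $ j = 0"
      "vec (card A) (\<lambda>k. c $ pick A k) = ls_estimator X A y"
    using extend_submodel_coefficients[OF A ls_normal_equations(1)[OF X A y inj]] by blast
  with submodel_mat_mult_restriction[OF X A c(1,2)] that[of c] show ?thesis
    by (simp add: residual_ss_def)
qed

lemma coercive_trivial_kernel:
  assumes a: "0 < a"
    and coer: "\<And>v. v \<in> carrier_vec p \<Longrightarrow> a * sq_euclidean_norm v \<le> sq_euclidean_norm (X *\<^sub>v v)"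
    and v: "v \<in> carrier_vec p" and 0: "X *\<^sub>v v = 0\<^sub>v n"
  shows "v = 0\<^sub>v p"
proof -
  have "a * sq_euclidean_norm v \<le> 0"
    using coer[OF v] 0 by (simp add: sq_euclidean_norm_zero)
  hence "sq_euclidean_norm v = 0"
    using a sq_euclidean_norm_nonneg[of v] by (auto simp: mult_le_0_iff)
  thus ?thesis
    using v by (intro eq_vecI) (auto simp: sq_euclidean_norm_def sum_nonneg_eq_0_iff)
qed

text \<open>
  With \<open>d\<close> the error of the estimated coefficients and \<open>w = X' e\<close>, coercivity bounds the residual sum of
  squares below by \<open>\<parallel>e\<parallel>\<^sup>2 + a \<parallel>d\<parallel>\<^sup>2 + 2 \<langle>d, w\<rangle>\<close>. Half of the quadratic term absorbs the cross term at the
  price of \<open>2 \<parallel>w\<parallel>\<^sup>2 / a\<close>; the other half is at least \<open>a \<delta> / 2\<close> once a nonzero coefficient is omitted,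
  because \<open>d\<close> equals \<open>\<beta>\<close> there.
\<close>

lemma residual_ss_lower:
  assumes X: "X \<in> carrier_mat n p" and A: "A \<subseteq> {..<p}"
    and \<beta>: "\<beta> \<in> carrier_vec p" and e: "e \<in> carrier_vec n"
    and a: "0 < a"
    and coer: "\<And>v. v \<in> carrier_vec p \<Longrightarrow> a * sq_euclidean_norm v \<le> sq_euclidean_norm (X *\<^sub>v v)"
    and \<delta>: "\<And>j. j < p \<Longrightarrow> j \<notin> A \<Longrightarrow> \<beta> $ j \<noteq> 0 \<Longrightarrow> \<delta> \<le> (\<beta> $ j)\<^sup>2"
  shows "sq_euclidean_norm e - 2 / a * sq_euclidean_norm (transpose_mat X *\<^sub>v e)
           \<le> residual_ss X A (X *\<^sub>v \<beta> + e)"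
    and "\<not> true_submodel \<beta> \<subseteq> A \<Longrightarrow>
          sq_euclidean_norm e + a / 2 * \<delta> - 2 / a * sq_euclidean_norm (transpose_mat X *\<^sub>v e)
           \<le> residual_ss X A (X *\<^sub>v \<beta> + e)"
proof -
  have inj: "v = 0\<^sub>v p" if "v \<in> carrier_vec p" "X *\<^sub>v v = 0\<^sub>v n" for v
    by (rule coercive_trivial_kernel[OF a _ that]) (rule coer)
  let ?y = "X *\<^sub>v \<beta> + e"
  have y: "?y \<in> carrier_vec n" using X \<beta> e by auto
  obtain c where c: "c \<in> carrier_vec p" "\<And>j. j < p \<Longrightarrow> j \<notin> A \<Longrightarrow> c $ j = 0"
    "residual_ss X A ?y = sq_euclidean_norm (?y - X *\<^sub>v c)"
    using residual_ss_eq_extended[OF X A y inj] by blast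
  define d where "d = \<beta> - c"
  define w where "w = transpose_mat X *\<^sub>v e"
  have d: "d \<in> carrier_vec p" and w: "w \<in> carrier_vec p" 
    using \<beta> c X e mult_mat_vec_carrier[of "transpose_mat X" p n e] by (auto simp: d_def w_def)
  have "?y - X *\<^sub>v c = X *\<^sub>v d + e"
    using X \<beta> c e by (auto simp: d_def mult_minus_distrib_mat_vec[of _ n p])
  moreover have "(X *\<^sub>v d) \<bullet> e = d \<bullet> w"
  proof -
    have "(X *\<^sub>v d) \<bullet> e = e \<bullet> (X *\<^sub>v d)" using X d e by (intro comm_scalar_prod[of _ n]) auto
    also have "\<dots> = w \<bullet> d"
      unfolding w_def using X d e by (intro transpose_vec_mult_scalar[symmetric, of X n p]) auto
    also have "\<dots> = d \<bullet> w" using d w by (intro comm_scalar_prod[of _ p]) auto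
    finally show ?thesis .
  qed
  ultimately have R: "residual_ss X A ?y
      = sq_euclidean_norm (X *\<^sub>v d) + 2 * (d \<bullet> w) + sq_euclidean_norm e"
    using X d e by (simp add: c(3) sq_euclidean_norm_add[of _ n])
  \<comment> \<open>Complete the square coordinatewise.\<close>
  have "0 \<le> (\<Sum>j<p. a / 2 * (d $ j + 2 / a * w $ j)\<^sup>2)"
    using a by (intro sum_nonneg) auto
  also have "\<dots> = (\<Sum>j<p. a / 2 * (d $ j)\<^sup>2 + 2 * (d $ j * w $ j) + 2 / a * (w $ j)\<^sup>2)"
    using a by (intro sum.cong) (auto simp: power2_eq_square field_simps)
  also have "\<dots> = a / 2 * sq_euclidean_norm d + 2 * (d \<bullet> w) + 2 / a * sq_euclidean_norm w"
    using d w by (simp add: sq_euclidean_norm_def scalar_prod_def sum.distrib sum_distrib_left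
        atLeast0LessThan)
  finally have "- 2 / a * sq_euclidean_norm w - a / 2 * sq_euclidean_norm d \<le> 2 * (d \<bullet> w)" by simp
  hence low: "sq_euclidean_norm e + a / 2 * sq_euclidean_norm d - 2 / a * sq_euclidean_norm w
      \<le> residual_ss X A ?y"
    using coer[OF d] by (simp add: R)
  moreover have "0 \<le> a / 2 * sq_euclidean_norm d"
    using a sq_euclidean_norm_nonneg[of d] by simp
  ultimately show "sq_euclidean_norm e - 2 / a * sq_euclidean_norm (transpose_mat X *\<^sub>v e)
           \<le> residual_ss X A ?y" unfolding w_def by linarith
  show "sq_euclidean_norm e + a / 2 * \<delta> - 2 / a * sq_euclidean_norm (transpose_mat X *\<^sub>v e)
           \<le> residual_ss X A ?y" if miss: "\<not> true_submodel \<beta> \<subseteq> A"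
  proof -
    obtain j where j: "j < p" "\<beta> $ j \<noteq> 0" "j \<notin> A"
      using \<beta> miss by (auto simp: true_submodel_def)
    have "\<delta> \<le> (d $ j)\<^sup>2" using \<delta>[OF j(1,3,2)] c j \<beta> by (simp add: d_def)
    also have "\<dots> \<le> sq_euclidean_norm d"
      unfolding sq_euclidean_norm_def using j d
      by (intro member_le_sum) auto
    finally have "a / 2 * \<delta> \<le> a / 2 * sq_euclidean_norm d" using a by simp
    with low show ?thesis unfolding w_def by linarith
  qed
qed

lemma residual_ss_upper:
  assumes X: "X \<in> carrier_mat n p" and A: "A \<subseteq> {..<p}"
    and \<beta>: "\<beta> \<in> carrier_vec p" and e: "e \<in> carrier_vec n"
    and inj: "\<And>v. v \<in> carrier_vec p \<Longrightarrow> X *\<^sub>v v = 0\<^sub>v n \<Longrightarrow> v = 0\<^sub>v p"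
    and true: "true_submodel \<beta> \<subseteq> A"
  shows "residual_ss X A (X *\<^sub>v \<beta> + e) \<le> sq_euclidean_norm e"
proof -
  have y: "X *\<^sub>v \<beta> + e \<in> carrier_vec n" using X \<beta> e by auto
  have "X *\<^sub>v \<beta> + e - X *\<^sub>v \<beta> = e" using X \<beta> e by auto
  thus ?thesis
    using residual_ss_minimal[OF X A y inj \<beta>] true \<beta> by (auto simp: true_submodel_def)
qed

section \<open>Coercivity of the design\<close>

text \<open>
  An algebraic substitute for minimising the quadratic form over the unit sphere. If \<open>S u\<^sub>j\<close> is the
  \<open>j\<close>-th unit vector, then \<open>v\<^sub>j = \<langle>u\<^sub>j, S v\<rangle>\<close>, and the Cauchy-Schwarz inequality for the inner product
  defined by \<open>S\<close> bounds \<open>v\<^sub>j\<^sup>2\<close> by a constant times \<open>\<langle>v, S v\<rangle>\<close>. Summing over \<open>j\<close> gives the claim.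
\<close>

lemma positive_definite_coercive:
  assumes "positive_definite p S"
  obtains l where "0 < l"
    "\<And>v. v \<in> carrier_vec p \<Longrightarrow> l * sq_euclidean_norm v \<le> v \<bullet> (S *\<^sub>v v)"
proof -
  from assms have S: "S \<in> carrier_mat p p" and sym: "transpose_mat S = S"
    and pos: "\<And>v. v \<in> carrier_vec p \<Longrightarrow> v \<noteq> 0\<^sub>v p \<Longrightarrow> v \<bullet> (S *\<^sub>v v) > 0"
    by (auto simp: positive_definite_def)
  have nonneg: "0 \<le> v \<bullet> (S *\<^sub>v v)" if "v \<in> carrier_vec p" for v
    using pos[OF that] S by (cases "v = 0\<^sub>v p") auto
  have symm: "v \<bullet> (S *\<^sub>v u) = u \<bullet> (S *\<^sub>v v)" if "u \<in> carrier_vec p" "v \<in> carrier_vec p" for u v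
  proof -
    have "v \<bullet> (S *\<^sub>v u) = (transpose_mat S *\<^sub>v v) \<bullet> u"
      using S that by (intro transpose_vec_mult_scalar[symmetric]) auto
    moreover have "(transpose_mat S *\<^sub>v v) \<bullet> u = u \<bullet> (S *\<^sub>v v)"
      unfolding sym using S that by (intro comm_scalar_prod[of _ p]) auto
    ultimately show ?thesis by simp
  qed
  have cs: "(u \<bullet> (S *\<^sub>v v))\<^sup>2 \<le> (u \<bullet> (S *\<^sub>v u)) * (v \<bullet> (S *\<^sub>v v))"
    if uv: "u \<in> carrier_vec p" "v \<in> carrier_vec p" for u v
  proof (cases "u = 0\<^sub>v p")
    case True
    thus ?thesis using S uv by simp
  next
    case False
    define a b c where "a = u \<bullet> (S *\<^sub>v u)" and "b = u \<bullet> (S *\<^sub>v v)" and "c = v \<bullet> (S *\<^sub>v v)"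
    have a: "a > 0" using pos[OF uv(1) False] by (simp add: a_def)
    \<comment> \<open>The minimiser of the quadratic polynomial \<open>c + 2 * t * b + t\<^sup>2 * a\<close>.\<close>
    define t where "t = - b / a"
    have "0 \<le> (v + t \<cdot>\<^sub>v u) \<bullet> (S *\<^sub>v (v + t \<cdot>\<^sub>v u))"
      using uv by (intro nonneg) auto
    also have "S *\<^sub>v (v + t \<cdot>\<^sub>v u) = S *\<^sub>v v + t \<cdot>\<^sub>v (S *\<^sub>v u)"
      using S uv by (simp add: mult_add_distrib_mat_vec[of _ p p] mult_mat_vec[of _ p p])
    also have "(v + t \<cdot>\<^sub>v u) \<bullet> (S *\<^sub>v v + t \<cdot>\<^sub>v (S *\<^sub>v u))
        = v \<bullet> (S *\<^sub>v v + t \<cdot>\<^sub>v (S *\<^sub>v u)) + t * (u \<bullet> (S *\<^sub>v v + t \<cdot>\<^sub>v (S *\<^sub>v u)))"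
      using S uv by (subst add_scalar_prod_distrib[of _ p]) auto
    also have "v \<bullet> (S *\<^sub>v v + t \<cdot>\<^sub>v (S *\<^sub>v u)) = c + t * b"
      using S uv symm[OF uv] by (subst scalar_prod_add_distrib[of _ p]) (auto simp: b_def c_def)
    also have "u \<bullet> (S *\<^sub>v v + t \<cdot>\<^sub>v (S *\<^sub>v u)) = b + t * a"
      using S uv by (subst scalar_prod_add_distrib[of _ p]) (auto simp: a_def b_def)
    finally have "0 \<le> c - b\<^sup>2 / a"
      using a by (simp add: t_def power2_eq_square field_simps)
    hence "b\<^sup>2 / a \<le> c" by simp
    thus ?thesis using a by (simp add: a_def b_def c_def field_simps)
  qed
  have ker: "v = 0\<^sub>v p" if "v \<in> carrier_vec p" "S *\<^sub>v v = 0\<^sub>v p" for v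
    using pos[OF that(1)] that by force
  obtain H where H: "H \<in> carrier_mat p p" "S * H = 1\<^sub>m p"
    using mat_inverse_if_trivial_kernel[OF S ker] by blast
  define u where "u = (\<lambda>j. H *\<^sub>v unit_vec p j)"
  have u: "u j \<in> carrier_vec p" for j using H by (simp add: u_def)
  have Su: "S *\<^sub>v u j = unit_vec p j" for j
    using S H by (simp add: u_def flip: assoc_mult_mat_vec[of _ p p _ p])
  \<comment> \<open>The summand 1 keeps \<open>K\<close> positive when \<open>p = 0\<close>.\<close>
  define K where "K = 1 + (\<Sum>j<p. u j \<bullet> (S *\<^sub>v u j))"
  have K: "K > 0" unfolding K_def using nonneg[OF u]
    by (intro add_pos_nonneg sum_nonneg) auto
  show ?thesis
  proof (rule that)
    show "0 < 1 / K" using K by simp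
    fix v :: "real vec" assume v: "v \<in> carrier_vec p"
    have "(v $ j)\<^sup>2 \<le> (u j \<bullet> (S *\<^sub>v u j)) * (v \<bullet> (S *\<^sub>v v))" if "j < p" for j
      using cs[OF u[of j] v] symm[OF u[of j] v] that v by (simp add: Su)
    hence "sq_euclidean_norm v \<le> (\<Sum>j<p. (u j \<bullet> (S *\<^sub>v u j)) * (v \<bullet> (S *\<^sub>v v)))"
      using v unfolding sq_euclidean_norm_def by (auto intro!: sum_mono)
    also have "\<dots> = (K - 1) * (v \<bullet> (S *\<^sub>v v))"
      by (simp add: K_def sum_distrib_right)
    also have "\<dots> \<le> K * (v \<bullet> (S *\<^sub>v v))"
      using nonneg[OF v] by (intro mult_right_mono) auto
    finally show "1 / K * sq_euclidean_norm v \<le> v \<bullet> (S *\<^sub>v v)"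
      using K by (simp add: field_simps)
  qed
qed

lemma quadratic_form_sum:
  fixes T :: "real mat"
  assumes "T \<in> carrier_mat p p" "v \<in> carrier_vec p"
  shows "v \<bullet> (T *\<^sub>v v) = (\<Sum>i<p. \<Sum>j<p. v $ i * v $ j * T $$ (i, j))"
  using assms
  by (auto simp: scalar_prod_def atLeast0LessThan sum_distrib_left mult_ac intro!: sum.cong)

text \<open>
  An entrywise perturbation of size \<open>q\<close> changes the quadratic form at \<open>v\<close> by at most \<open>q p \<parallel>v\<parallel>\<^sup>2\<close>, since
  \<open>2 \<bar>v\<^sub>i v\<^sub>j\<bar> \<le> v\<^sub>i\<^sup>2 + v\<^sub>j\<^sup>2\<close>. So half of the coercivity constant of the limit survives for large \<open>n\<close>.
\<close>

lemma eventually_coercive: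
  assumes X: "\<And>n. X n \<in> carrier_mat n p" and pd: "positive_definite p \<Sigma>"
    and lim: "mat_tendsto p p (\<lambda>n. (1 / real n) \<cdot>\<^sub>m (transpose_mat (X n) * X n)) \<Sigma>"
  obtains l where "0 < l"
    "\<forall>\<^sub>F n in sequentially. \<forall>v \<in> carrier_vec p.
        (real n * l) * sq_euclidean_norm v \<le> sq_euclidean_norm (X n *\<^sub>v v)"
proof -
  obtain k where k: "0 < k"
    "\<And>v. v \<in> carrier_vec p \<Longrightarrow> k * sq_euclidean_norm v \<le> v \<bullet> (\<Sigma> *\<^sub>v v)"
    using positive_definite_coercive[OF pd] by blast
  have S: "\<Sigma> \<in> carrier_mat p p" using pd by (simp add: positive_definite_def)
  define G where "G = (\<lambda>n. (1 / real n) \<cdot>\<^sub>m (transpose_mat (X n) * X n))"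
  have G: "G n \<in> carrier_mat p p" for n using X[of n] by (auto simp: G_def)
  \<comment> \<open>Chosen so that \<open>q * p \<le> k / 2\<close>.\<close>
  define q where "q = k / (2 * (real p + 1))"
  have q: "q > 0" using k by (simp add: q_def)
  have "\<forall>\<^sub>F n in sequentially. \<forall>i\<in>{..<p}. \<forall>j\<in>{..<p}. dist (G n $$ (i, j)) (\<Sigma> $$ (i, j)) < q"
    using lim q unfolding mat_tendsto_def G_def
    by (intro eventually_ball_finite ballI tendstoD) auto
  hence "\<forall>\<^sub>F n in sequentially. \<forall>v \<in> carrier_vec p.
        (real n * (k / 2)) * sq_euclidean_norm v \<le> sq_euclidean_norm (X n *\<^sub>v v)"
    using eventually_gt_at_top[of 0]
  proof eventually_elim
    case (elim n)
    show ?case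
    proof
      fix v :: "real vec" assume v: "v \<in> carrier_vec p"
      have "v \<bullet> (\<Sigma> *\<^sub>v v) - v \<bullet> (G n *\<^sub>v v)
          = (\<Sum>i<p. \<Sum>j<p. v $ i * v $ j * (\<Sigma> $$ (i, j) - G n $$ (i, j)))"
        by (simp add: quadratic_form_sum[OF S v] quadratic_form_sum[OF G v] sum_subtractf algebra_simps)
      also have "\<dots> \<le> (\<Sum>i<p. \<Sum>j<p. q * ((v $ i)\<^sup>2 + (v $ j)\<^sup>2) / 2)"
      proof (intro sum_mono)
        fix i j assume ij: "i \<in> {..<p}" "j \<in> {..<p}"
        have "\<bar>\<Sigma> $$ (i, j) - G n $$ (i, j)\<bar> \<le> q"
          using elim ij by (force simp: dist_real_def abs_minus_commute)
        moreover have "\<bar>v $ i * v $ j\<bar> \<le> ((v $ i)\<^sup>2 + (v $ j)\<^sup>2) / 2"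
          using zero_le_power2[of "\<bar>v $ i\<bar> - \<bar>v $ j\<bar>"]
          by (simp add: power2_eq_square algebra_simps abs_mult) 
        ultimately have "\<bar>v $ i * v $ j\<bar> * \<bar>\<Sigma> $$ (i, j) - G n $$ (i, j)\<bar>
            \<le> ((v $ i)\<^sup>2 + (v $ j)\<^sup>2) / 2 * q"
          by (intro mult_mono) auto
        moreover have "v $ i * v $ j * (\<Sigma> $$ (i, j) - G n $$ (i, j))
            \<le> \<bar>v $ i * v $ j\<bar> * \<bar>\<Sigma> $$ (i, j) - G n $$ (i, j)\<bar>"
          unfolding abs_mult[symmetric] by (rule abs_ge_self)
        ultimately show "v $ i * v $ j * (\<Sigma> $$ (i, j) - G n $$ (i, j)) \<le> q * ((v $ i)\<^sup>2 + (v $ j)\<^sup>2) / 2"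
          by (simp only: times_divide_eq_left mult.commute[of q]) 
      qed
      also have "\<dots> = q * real p * sq_euclidean_norm v"
        using v by (simp add: sq_euclidean_norm_def sum.distrib sum_distrib_left[symmetric]
            sum_divide_distrib[symmetric] algebra_simps)
      also have "\<dots> \<le> k / 2 * sq_euclidean_norm v"
        using k sq_euclidean_norm_nonneg[of v]
        by (intro mult_right_mono) (auto simp: q_def field_simps)
      finally have "k / 2 * sq_euclidean_norm v \<le> v \<bullet> (G n *\<^sub>v v)"
        using k(2)[OF v] by simp
      also have "v \<bullet> (G n *\<^sub>v v) = 1 / real n * (v \<bullet> ((transpose_mat (X n) * X n) *\<^sub>v v))"
        using X[of n] v quadratic_form_sum[OF G[of n] v]
          quadratic_form_sum[of "transpose_mat (X n) * X n" p v]
        by (simp add: G_def sum_divide_distrib)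
      also have "\<dots> = sq_euclidean_norm (X n *\<^sub>v v) / real n"
        using sq_euclidean_norm_mult_mat_vec[OF X v] by simp
      finally show "(real n * (k / 2)) * sq_euclidean_norm v \<le> sq_euclidean_norm (X n *\<^sub>v v)"
        using elim by (simp add: field_simps)
    qed
  qed
  with that[of "k / 2"] k show ?thesis by simp
qed

section \<open>Comparison of the objective functions\<close>

text \<open>
  The deterministic comparison. Here \<open>s\<close> is the bound for the noise terms, \<open>over\<close> says that one
  additional penalty unit outweighs the overfitting gain, and \<open>under\<close> that the bias of a misspecified
  submodel outweighs the whole penalty of the true one.
\<close>

lemma objective_less_objective:
  fixes N :: real
  assumes X: "X \<in> carrier_mat n p" and n: "0 < n" and N: "N = real n"
    and \<beta>: "\<beta> \<in> carrier_vec p" and e: "e \<in> carrier_vec n"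
    and l: "0 < l"
    and coer: "\<And>v. v \<in> carrier_vec p \<Longrightarrow> N * l * sq_euclidean_norm v \<le> sq_euclidean_norm (X *\<^sub>v v)"
    and \<delta>: "\<And>j. j < p \<Longrightarrow> \<beta> $ j \<noteq> 0 \<Longrightarrow> \<delta> \<le> (\<beta> $ j)\<^sup>2"
    and score: "sq_euclidean_norm (transpose_mat X *\<^sub>v e) \<le> N * s"
    and e_upper: "sq_euclidean_norm e \<le> N * s"
    and e_lower: "c * N \<le> sq_euclidean_norm e"
    and over: "(1 + real p * ln N / N) * (2 * s / l) < c * ln N"
    and under: "real p * ln N * s + 2 * s / l < N * (l * \<delta> / 2)"
    and A: "A \<subseteq> {..<p}" "A \<noteq> true_submodel \<beta>"
  shows "objective X (X *\<^sub>v \<beta> + e) (true_submodel \<beta>) < objective X (X *\<^sub>v \<beta> + e) A"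
proof -
  let ?A\<^sub>0 = "true_submodel \<beta>"
  let ?y = "X *\<^sub>v \<beta> + e"
  define E where "E = sq_euclidean_norm e"
  define L where "L = ln N / N"
  have N1: "N \<ge> 1" using n N by simp
  hence L: "L \<ge> 0" by (simp add: L_def)
  have obj: "objective X ?y B = (1 + real (card B) * L) * residual_ss X B ?y" for B
    using X by (simp add: objective_def residual_ss_def L_def N)
  have A0: "?A\<^sub>0 \<subseteq> {..<p}" using \<beta> by (auto simp: true_submodel_def)
  have fin: "finite A" using A(1) finite_subset by blast
  have cards: "card A \<le> p" "card ?A\<^sub>0 \<le> p"
    using card_mono[OF _ A(1)] card_mono[OF _ A0] by simp_all
  have a: "0 < N * l" using N1 l by simp
  have W: "2 / (N * l) * sq_euclidean_norm (transpose_mat X *\<^sub>v e) \<le> 2 * s / l"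
  proof -
    have "2 / (N * l) * sq_euclidean_norm (transpose_mat X *\<^sub>v e) \<le> 2 / (N * l) * (N * s)"
      using a score by (intro mult_left_mono) auto
    thus ?thesis using N1 by simp
  qed
  have E0: "0 \<le> E" by (simp add: E_def sq_euclidean_norm_nonneg)
  have "0 \<le> N * s" using E0 e_upper by (simp add: E_def)
  hence s: "0 \<le> s" using N1 by (simp add: zero_le_mult_iff)
  have R0: "residual_ss X ?A\<^sub>0 ?y \<le> E"
    unfolding E_def by (rule residual_ss_upper[OF X A0 \<beta> e])
      (auto intro: coercive_trivial_kernel[OF a] coer)
  have "E - 2 / (N * l) * sq_euclidean_norm (transpose_mat X *\<^sub>v e) \<le> residual_ss X A ?y"
    unfolding E_def by (rule residual_ss_lower(1)[OF X A(1) \<beta> e a]) (use coer \<delta> in auto)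
  hence RA: "E - 2 * s / l \<le> residual_ss X A ?y" using W by simp
  have "objective X ?y ?A\<^sub>0 \<le> (1 + real (card ?A\<^sub>0) * L) * E"
    unfolding obj using R0 L by (intro mult_left_mono) auto
  also have "\<dots> < (1 + real (card A) * L) * residual_ss X A ?y"
  proof (cases "?A\<^sub>0 \<subseteq> A")
    case True
    hence "card ?A\<^sub>0 < card A" using A(2) fin by (intro psubset_card_mono) auto
    hence "real (card ?A\<^sub>0) + 1 \<le> real (card A)" by simp
    hence "(real (card ?A\<^sub>0) + 1) * (L * E) \<le> real (card A) * (L * E)"
      using L E0 by (intro mult_right_mono) auto
    moreover have "c * ln N \<le> L * E"
    proof -
      have "L * (c * N) \<le> L * E" using e_lower L by (intro mult_left_mono) (auto simp: E_def)
      thus ?thesis using N1 by (simp add: L_def mult.commute)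
    qed
    moreover have "(1 + real (card A) * L) * (2 * s / l) \<le> (1 + real p * L) * (2 * s / l)"
      using cards L s l by (intro mult_right_mono add_left_mono) auto
    moreover have "(1 + real p * L) * (2 * s / l) < c * ln N"
      using over by (simp add: L_def)
    ultimately have "(1 + real (card ?A\<^sub>0) * L) * E < (1 + real (card A) * L) * (E - 2 * s / l)"
      by (simp add: algebra_simps)
    also have "\<dots> \<le> (1 + real (card A) * L) * residual_ss X A ?y"
      using RA L by (intro mult_left_mono) auto
    finally show ?thesis .
  next
    case False
    have "real (card ?A\<^sub>0) * (L * E) \<le> real p * (L * (N * s))"
      using cards L E0 e_upper by (intro mult_mono) (auto simp: E_def)
    also have "L * (N * s) = ln N * s" using N1 by (simp add: L_def)
    finally have "(1 + real (card ?A\<^sub>0) * L) * E < E + N * l / 2 * \<delta> - 2 * s / l"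
      using under by (simp add: algebra_simps)
    also have "\<dots> \<le> E + N * l / 2 * \<delta>
        - 2 / (N * l) * sq_euclidean_norm (transpose_mat X *\<^sub>v e)"
      using W by simp
    also have "\<dots> \<le> residual_ss X A ?y"
      unfolding E_def by (rule residual_ss_lower(2)[OF X A(1) \<beta> e a]) (use coer \<delta> False in auto)
    also have "\<dots> \<le> (1 + real (card A) * L) * residual_ss X A ?y"
    proof -
      have "0 \<le> residual_ss X A ?y" by (simp add: residual_ss_def sq_euclidean_norm_nonneg)
      hence "1 * residual_ss X A ?y \<le> (1 + real (card A) * L) * residual_ss X A ?y"
        using L by (intro mult_right_mono) auto
      thus ?thesis by simp
    qed
    finally show ?thesis .
  qed
  finally show ?thesis by (simp only: obj)
qed

text \<open>
  With the noise bound \<open>s = sqrt (ln n)\<close> both margins open up. Any \<open>s\<close> that tends to infinity more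
  slowly than \<open>ln n\<close> would do: it has to diverge for Markov's inequality and to be of smaller order
  than the penalty.
\<close>

lemma eventually_over_margin:
  fixes c l q :: real
  assumes "0 < c" "0 < l"
  shows "\<forall>\<^sub>F n in sequentially. (1 + q * ln (real n) / real n) * (2 * sqrt (ln (real n)) / l) < c * ln (real n)"
  using assms by real_asymp

lemma eventually_under_margin:
  fixes l \<delta> :: real
  assumes "0 < \<delta>" "0 < l"
  shows "\<forall>\<^sub>F n in sequentially. real p * ln (real n) * sqrt (ln (real n)) + 2 * sqrt (ln (real n)) / l
            < real n * (l * \<delta> / 2)"
proof (cases "p = 0")
  case True
  thus ?thesis using assms by simp real_asymp
next
  case False
  define q where "q = real p"
  have "q > 0" using False by (simp add: q_def)
  thus ?thesis unfolding q_def[symmetric] using assms by real_asymp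
qed

text \<open>
  The bound is a minimum over finitely many squares, to which 1 is added so that it exists also when all
  coefficients vanish.
\<close>

lemma nonzero_coefficients_bounded_below:
  fixes \<beta> :: "real vec"
  obtains \<delta> where "0 < \<delta>" "\<And>j. j < p \<Longrightarrow> \<beta> $ j \<noteq> 0 \<Longrightarrow> \<delta> \<le> (\<beta> $ j)\<^sup>2"
proof
  let ?S = "insert 1 ((\<lambda>j. (\<beta> $ j)\<^sup>2) ` {j. j < p \<and> \<beta> $ j \<noteq> 0})"
  show "0 < Min ?S" by (subst Min_gr_iff) auto
  show "Min ?S \<le> (\<beta> $ j)\<^sup>2" if "j < p" "\<beta> $ j \<noteq> 0" for j
    using that by (intro Min_le) auto
qed

section \<open>Square-integrable independent and identically distributed errors\<close>

locale iid_errors = prob_space M for M :: "'w measure" +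
  fixes \<epsilon> :: "nat \<Rightarrow> 'w \<Rightarrow> real" and \<sigma> :: real
  assumes indep: "indep_vars (\<lambda>_. borel) \<epsilon> UNIV"
    and ident: "\<And>i. distr M borel (\<epsilon> i) = distr M borel (\<epsilon> 0)"
    and sq_integrable: "\<And>i. integrable M (\<lambda>\<omega>. (\<epsilon> i \<omega>)\<^sup>2)"
    and centred: "\<And>i. expectation (\<epsilon> i) = 0"
    and variance: "\<And>i. variance (\<epsilon> i) = \<sigma>\<^sup>2"
    and sigma_pos: "\<sigma> > 0"
begin

lemma error_measurable [measurable]: "\<epsilon> i \<in> borel_measurable M"
  using indep by (auto simp: indep_vars_def)

lemma error_integrable: "integrable M (\<epsilon> i)"
  by (rule square_integrable_imp_integrable[OF error_measurable sq_integrable])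

lemma second_moment: "expectation (\<lambda>\<omega>. (\<epsilon> i \<omega>)\<^sup>2) = \<sigma>\<^sup>2"
  using variance[of i] centred[of i] by simp

lemma error_product:
  shows "integrable M (\<lambda>\<omega>. \<epsilon> i \<omega> * \<epsilon> k \<omega>)"
    and "expectation (\<lambda>\<omega>. \<epsilon> i \<omega> * \<epsilon> k \<omega>) = (if i = k then \<sigma>\<^sup>2 else 0)"
proof -
  have "integrable M (\<lambda>\<omega>. \<epsilon> i \<omega> * \<epsilon> k \<omega>)
      \<and> expectation (\<lambda>\<omega>. \<epsilon> i \<omega> * \<epsilon> k \<omega>) = (if i = k then \<sigma>\<^sup>2 else 0)"
  proof (cases "i = k")
    case True
    thus ?thesis using sq_integrable[of k] second_moment[of k] by (simp add: power2_eq_square)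
  next
    case False
    have "indep_vars (\<lambda>_. borel) \<epsilon> {i, k}" by (rule indep_vars_subset[OF indep]) auto
    from indep_vars_lebesgue_integral[OF _ this error_integrable]
      indep_vars_integrable[OF _ this error_integrable]
    show ?thesis using False by (simp add: centred)
  qed
  thus "integrable M (\<lambda>\<omega>. \<epsilon> i \<omega> * \<epsilon> k \<omega>)"
    and "expectation (\<lambda>\<omega>. \<epsilon> i \<omega> * \<epsilon> k \<omega>) = (if i = k then \<sigma>\<^sup>2 else 0)" by blast+
qed

text \<open>
  The errors are uncorrelated, so the mixed terms of the expanded square have expectation 0.
\<close>

lemma linear_combination_sq:
  shows "integrable M (\<lambda>\<omega>. (\<Sum>i<n. a i * \<epsilon> i \<omega>)\<^sup>2)"
    and "expectation (\<lambda>\<omega>. (\<Sum>i<n. a i * \<epsilon> i \<omega>)\<^sup>2) = \<sigma>\<^sup>2 * (\<Sum>i<n. (a i)\<^sup>2)"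
proof -
  have eq: "(\<Sum>i<n. a i * \<epsilon> i \<omega>)\<^sup>2 = (\<Sum>i<n. \<Sum>k<n. a i * a k * (\<epsilon> i \<omega> * \<epsilon> k \<omega>))" for \<omega>
    by (simp add: power2_eq_square sum_product mult_ac)
  show "integrable M (\<lambda>\<omega>. (\<Sum>i<n. a i * \<epsilon> i \<omega>)\<^sup>2)"
    unfolding eq by (intro Bochner_Integration.integrable_sum integrable_mult_right error_product)
  have "expectation (\<lambda>\<omega>. (\<Sum>i<n. a i * \<epsilon> i \<omega>)\<^sup>2)
      = (\<Sum>i<n. \<Sum>k<n. a i * a k * (if i = k then \<sigma>\<^sup>2 else 0))"
    unfolding eq
    by (simp add: Bochner_Integration.integral_sum Bochner_Integration.integrable_sum error_product
        integrable_mult_right)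
  also have "\<dots> = (\<Sum>i<n. (a i)\<^sup>2 * \<sigma>\<^sup>2)"
    by (intro sum.cong refl) (simp add: if_distrib sum.delta' power2_eq_square cong: if_cong)
  finally show "expectation (\<lambda>\<omega>. (\<Sum>i<n. a i * \<epsilon> i \<omega>)\<^sup>2) = \<sigma>\<^sup>2 * (\<Sum>i<n. (a i)\<^sup>2)"
    by (simp add: sum_distrib_left mult.commute)
qed

lemma error_norm_Markov:
  assumes "0 < n" "0 < s"
  shows "prob {\<omega> \<in> space M. real n * s \<le> (\<Sum>i<n. (\<epsilon> i \<omega>)\<^sup>2)} \<le> \<sigma>\<^sup>2 / s"
proof -
  have "prob {\<omega> \<in> space M. real n * s \<le> (\<Sum>i<n. (\<epsilon> i \<omega>)\<^sup>2)}
      \<le> expectation (\<lambda>\<omega>. \<Sum>i<n. (\<epsilon> i \<omega>)\<^sup>2) / (real n * s)"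
    using assms sq_integrable
    by (intro integral_Markov_inequality_measure[where A = "space M"])
      (auto intro!: sum_nonneg Bochner_Integration.integrable_sum)
  also have "\<dots> = \<sigma>\<^sup>2 / s"
    using assms by (simp add: Bochner_Integration.integral_sum sq_integrable second_moment)
  finally show ?thesis .
qed

lemma score_Markov:
  assumes "0 < n" "0 < s"
  shows "prob {\<omega> \<in> space M. real n * s \<le> (\<Sum>j<p. (\<Sum>i<n. x i j * \<epsilon> i \<omega>)\<^sup>2)}
           \<le> \<sigma>\<^sup>2 * (\<Sum>j<p. (\<Sum>i<n. (x i j)\<^sup>2) / real n) / s"
proof -
  have "prob {\<omega> \<in> space M. real n * s \<le> (\<Sum>j<p. (\<Sum>i<n. x i j * \<epsilon> i \<omega>)\<^sup>2)}
      \<le> expectation (\<lambda>\<omega>. \<Sum>j<p. (\<Sum>i<n. x i j * \<epsilon> i \<omega>)\<^sup>2) / (real n * s)"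
    using assms linear_combination_sq
    by (intro integral_Markov_inequality_measure[where A = "space M"])
      (auto intro!: sum_nonneg Bochner_Integration.integrable_sum)
  also have "\<dots> = \<sigma>\<^sup>2 * (\<Sum>j<p. (\<Sum>i<n. (x i j)\<^sup>2) / real n) / s"
    using assms
    by (simp add: Bochner_Integration.integral_sum linear_combination_sq sum_distrib_left[symmetric]
        sum_divide_distrib[symmetric])
  finally show ?thesis .
qed

text \<open>
  A one-sided law of large numbers. The squared errors need not have a variance, but a lower bound
  survives truncation: the variables \<open>min 1 (\<epsilon> i)\<^sup>2\<close> are bounded, their mean \<open>m\<close> is positive because the
  errors do not vanish almost surely, and by Hoeffding's inequality their average falls below \<open>m / 2\<close>
  only with exponentially small probability.
\<close>

lemma error_norm_lower:
  obtains c where "0 < c"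
    "(\<lambda>n. prob {\<omega> \<in> space M. (\<Sum>i<n. (\<epsilon> i \<omega>)\<^sup>2) \<le> c * real n}) \<longlonglongrightarrow> 0"
proof -
  define Y where "Y = (\<lambda>i \<omega>. min 1 ((\<epsilon> i \<omega>)\<^sup>2))"
  define m where "m = expectation (Y 0)"
  have Ym [measurable]: "Y i \<in> borel_measurable M" for i by (simp add: Y_def)
  have Yint: "integrable M (Y i)" for i
    by (rule integrable_const_bound[where B = 1]) (auto simp: Y_def)
  have EY: "expectation (Y i) = m" for i
  proof -
    have eq: "expectation (Y i) = (\<integral>x. min 1 (x\<^sup>2) \<partial>distr M borel (\<epsilon> i))" for i
      unfolding Y_def by (subst integral_distr) auto
    show ?thesis unfolding m_def by (simp only: eq ident[of i])
  qed
  have "m \<noteq> 0"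
  proof
    assume "m = 0"
    hence "AE \<omega> in M. Y 0 \<omega> = 0"
      using integral_nonneg_eq_0_iff_AE[OF Yint[of 0]] by (auto simp: m_def Y_def)
    hence "AE \<omega> in M. (\<epsilon> 0 \<omega>)\<^sup>2 = 0"
      by eventually_elim (auto simp: Y_def min_def split: if_splits)
    hence "expectation (\<lambda>\<omega>. (\<epsilon> 0 \<omega>)\<^sup>2) = 0" by (simp add: integral_eq_zero_AE)
    thus False using second_moment[of 0] sigma_pos by simp
  qed
  moreover have "m \<ge> 0" unfolding m_def by (intro integral_nonneg_AE) (auto simp: Y_def)
  ultimately have m: "m > 0" by simp
  have bound: "prob {\<omega> \<in> space M. (\<Sum>i<n. (\<epsilon> i \<omega>)\<^sup>2) \<le> m / 2 * real n} \<le> exp (- (m\<^sup>2 / 2) * real n)"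
    if n: "n > 0" for n
  proof -
    interpret Y: Hoeffding_ineq M "{..<n}" Y "\<lambda>_. 0" "\<lambda>_. 1" "real n * m"
    proof unfold_locales
      show "indep_vars (\<lambda>_. borel) Y {..<n}"
        unfolding Y_def
        by (rule indep_vars_compose2[OF indep_vars_subset[OF indep]]) auto
    qed (auto simp: Y_def EY[unfolded Y_def])
    have "prob {\<omega> \<in> space M. (\<Sum>i<n. (\<epsilon> i \<omega>)\<^sup>2) \<le> m / 2 * real n}
        \<le> prob {\<omega> \<in> space M. (\<Sum>i<n. Y i \<omega>) \<le> real n * m - real n * m / 2}"
    proof (intro finite_measure_mono subsetI)
      fix \<omega> assume "\<omega> \<in> {\<omega> \<in> space M. (\<Sum>i<n. (\<epsilon> i \<omega>)\<^sup>2) \<le> m / 2 * real n}"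
      moreover have "(\<Sum>i<n. Y i \<omega>) \<le> (\<Sum>i<n. (\<epsilon> i \<omega>)\<^sup>2)"
        by (intro sum_mono) (auto simp: Y_def)
      ultimately show "\<omega> \<in> {\<omega> \<in> space M. (\<Sum>i<n. Y i \<omega>) \<le> real n * m - real n * m / 2}"
        by (auto simp: algebra_simps)
    qed auto
    also have "\<dots> \<le> exp (- 2 * (real n * m / 2)\<^sup>2 / (\<Sum>i<n. (1 - 0)\<^sup>2))"
      using m n by (intro Y.Hoeffding_ineq_le) auto
    also have "- 2 * (real n * m / 2)\<^sup>2 / (\<Sum>i<n. (1 - 0)\<^sup>2) = - (m\<^sup>2 / 2) * real n"
      using n by (simp add: power2_eq_square field_simps)
    finally show ?thesis .
  qed
  have "(\<lambda>n. exp (- (m\<^sup>2 / 2) * real n)) \<longlonglongrightarrow> 0"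
    using m by real_asymp
  hence "(\<lambda>n. prob {\<omega> \<in> space M. (\<Sum>i<n. (\<epsilon> i \<omega>)\<^sup>2) \<le> m / 2 * real n}) \<longlonglongrightarrow> 0"
    by (intro tendsto_sandwich[OF _ eventually_mono[OF eventually_gt_at_top[of 0] bound] tendsto_const])
      simp_all
  with that[of "m / 2"] m show ?thesis by simp
qed

lemma error_norm_upper_negligible:
  "(\<lambda>n. prob {\<omega> \<in> space M. real n * sqrt (ln (real n)) \<le> (\<Sum>i<n. (\<epsilon> i \<omega>)\<^sup>2)}) \<longlonglongrightarrow> 0"
proof (rule tendsto_sandwich[OF _ _ tendsto_const])
  show "\<forall>\<^sub>F n in sequentially. prob {\<omega> \<in> space M. real n * sqrt (ln (real n)) \<le> (\<Sum>i<n. (\<epsilon> i \<omega>)\<^sup>2)}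
      \<le> \<sigma>\<^sup>2 / sqrt (ln (real n))"
    using eventually_gt_at_top[of 1] by eventually_elim (intro error_norm_Markov, auto)
  show "(\<lambda>n. \<sigma>\<^sup>2 / sqrt (ln (real n))) \<longlonglongrightarrow> 0"
    using sigma_pos by real_asymp
qed auto

text \<open>
  The expectation of \<open>\<parallel>X' e\<parallel>\<^sup>2 / n\<close> is \<open>\<sigma>\<^sup>2\<close> times the trace of \<open>X' X / n\<close>, which converges and is
  therefore bounded.
\<close>

lemma score_negligible:
  assumes X: "\<And>n. X n \<in> carrier_mat n p"
    and lim: "mat_tendsto p p (\<lambda>n. (1 / real n) \<cdot>\<^sub>m (transpose_mat (X n) * X n)) \<Sigma>"
  shows "(\<lambda>n. prob {\<omega> \<in> space M. real n * sqrt (ln (real n))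
           \<le> sq_euclidean_norm (transpose_mat (X n) *\<^sub>v vec n (\<lambda>i. \<epsilon> i \<omega>))}) \<longlonglongrightarrow> 0"
proof (rule tendsto_sandwich[OF _ _ tendsto_const])
  define G where "G = (\<lambda>n. (1 / real n) \<cdot>\<^sub>m (transpose_mat (X n) * X n))"
  have diag: "G n $$ (j, j) = (\<Sum>i<n. (X n $$ (i, j))\<^sup>2) / real n" if "j < p" for n j
    using X[of n] that by (auto simp: G_def scalar_prod_def atLeast0LessThan power2_eq_square
        intro!: sum.cong arg_cong[where f = "\<lambda>t. t / real n"])
  have norm: "sq_euclidean_norm (transpose_mat (X n) *\<^sub>v vec n (\<lambda>i. \<epsilon> i \<omega>))
      = (\<Sum>j<p. (\<Sum>i<n. X n $$ (i, j) * \<epsilon> i \<omega>)\<^sup>2)" for n \<omega>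
    using X[of n] by (auto simp: sq_euclidean_norm_def scalar_prod_def atLeast0LessThan
        intro!: sum.cong arg_cong[where f = "\<lambda>t. t\<^sup>2"])
  show "\<forall>\<^sub>F n in sequentially. prob {\<omega> \<in> space M. real n * sqrt (ln (real n))
           \<le> sq_euclidean_norm (transpose_mat (X n) *\<^sub>v vec n (\<lambda>i. \<epsilon> i \<omega>))}
      \<le> \<sigma>\<^sup>2 * (\<Sum>j<p. G n $$ (j, j)) / sqrt (ln (real n))"
    using eventually_gt_at_top[of 1]
  proof eventually_elim
    case (elim n)
    thus ?case
      using score_Markov[where n = n and s = "sqrt (ln (real n))" and p = p and x = "\<lambda>i j. X n $$ (i, j)"]
      by (simp add: norm diag)
  qed
  have "(\<lambda>n. \<sigma>\<^sup>2 * (\<Sum>j<p. G n $$ (j, j))) \<longlonglongrightarrow> \<sigma>\<^sup>2 * (\<Sum>j<p. \<Sigma> $$ (j, j))"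
    using lim unfolding mat_tendsto_def G_def by (intro tendsto_mult tendsto_sum tendsto_const) auto
  moreover have "filterlim (\<lambda>n. sqrt (ln (real n))) at_infinity sequentially"
    by (rule filterlim_at_top_imp_at_infinity) real_asymp
  ultimately show "(\<lambda>n. \<sigma>\<^sup>2 * (\<Sum>j<p. G n $$ (j, j)) / sqrt (ln (real n))) \<longlonglongrightarrow> 0"
    by (rule tendsto_divide_0)
qed auto

end

section \<open>Measurability of the objective functions\<close>

lemma mult_mat_vec_measurable:
  fixes B :: "real mat"
  assumes "\<And>\<omega>. dim_vec (f \<omega>) = m" "\<And>i. i < m \<Longrightarrow> (\<lambda>\<omega>. f \<omega> $ i) \<in> borel_measurable M"
    and "i < dim_row B"
  shows "(\<lambda>\<omega>. (B *\<^sub>v f \<omega>) $ i) \<in> borel_measurable M"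
  using assms by (auto simp: scalar_prod_def intro!: borel_measurable_sum borel_measurable_times)

text \<open>
  Sets that are not measurable have measure 0 by convention, so the separation event must be shown to
  be measurable. The estimator is a fixed matrix applied to the response, so for a given design the objective is a
  polynomial in the errors. This also covers a singular Gram matrix, where the fixed matrix is arbitrary.
\<close>

lemma objective_measurable:
  assumes X: "X \<in> carrier_mat n p"
    and [measurable]: "\<And>i. i < n \<Longrightarrow> \<epsilon> i \<in> borel_measurable M"
  shows "(\<lambda>\<omega>. objective X (response X \<beta> (\<lambda>i. \<epsilon> i \<omega>)) A) \<in> borel_measurable M"
proof -
  define y where "y = (\<lambda>\<omega>. response X \<beta> (\<lambda>i. \<epsilon> i \<omega>))"
  define Z where "Z = submodel_mat X A"
  define H where "H = the (mat_inverse (transpose_mat Z * Z))"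
  have dimZ: "dim_row Z = n"
    using X by (simp add: Z_def submodel_mat_def dim_submatrix)
  have dimy: "dim_vec (y \<omega>) = n" for \<omega> using X by (simp add: y_def response_def)
  have y: "(\<lambda>\<omega>. y \<omega> $ i) \<in> borel_measurable M" if "i < n" for i
    using X that by (simp add: y_def response_def)
  have "(\<lambda>\<omega>. (transpose_mat Z *\<^sub>v y \<omega>) $ i) \<in> borel_measurable M" if "i < dim_col Z" for i
    by (rule mult_mat_vec_measurable[OF dimy y]) (use that in auto)
  hence "(\<lambda>\<omega>. (H *\<^sub>v (transpose_mat Z *\<^sub>v y \<omega>)) $ i) \<in> borel_measurable M" if "i < dim_row H" for i
    by (rule mult_mat_vec_measurable[rotated]) (use that in auto)
  hence fit: "(\<lambda>\<omega>. (Z *\<^sub>v (H *\<^sub>v (transpose_mat Z *\<^sub>v y \<omega>))) $ i) \<in> borel_measurable M" if "i < n" for i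
    by (rule mult_mat_vec_measurable[rotated]) (use that dimZ in auto)
  have "(\<lambda>\<omega>. sq_euclidean_norm (y \<omega> - Z *\<^sub>v (H *\<^sub>v (transpose_mat Z *\<^sub>v y \<omega>)))) \<in> borel_measurable M"
    unfolding sq_euclidean_norm_def using y fit dimZ
    by (auto intro!: borel_measurable_sum borel_measurable_power borel_measurable_diff)
  thus ?thesis
    by (simp add: objective_def ls_estimator_def Let_def y_def Z_def H_def)
qed

lemma less_INF_ereal_iff:
  assumes "finite B"
  shows "ereal x < (INF A\<in>B. ereal (f A)) \<longleftrightarrow> (\<forall>A\<in>B. x < f A)"
proof (cases "B = {}")
  case False
  thus ?thesis using assms by (subst finite_less_Inf_iff) auto
qed (simp add: top_ereal_def)

section \<open>Separation with probability tending to one\<close>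

lemma (in prob_space) prob_tendsto_1:
  fixes P :: "nat \<Rightarrow> 'a \<Rightarrow> bool"
  assumes P: "\<And>n. {\<omega> \<in> space M. P n \<omega>} \<in> events"
    and Q: "\<And>n. {\<omega> \<in> space M. Q n \<omega>} \<in> events"
    and lim: "(\<lambda>n. prob {\<omega> \<in> space M. Q n \<omega>}) \<longlonglongrightarrow> 0"
    and imp: "\<forall>\<^sub>F n in sequentially. \<forall>\<omega> \<in> space M. P n \<omega> \<or> Q n \<omega>"
  shows "(\<lambda>n. prob {\<omega> \<in> space M. P n \<omega>}) \<longlonglongrightarrow> 1"
proof (rule tendsto_sandwich)
  show "\<forall>\<^sub>F n in sequentially. 1 - prob {\<omega> \<in> space M. Q n \<omega>} \<le> prob {\<omega> \<in> space M. P n \<omega>}"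
    using imp
  proof eventually_elim
    case (elim n)
    have "1 = prob (space M)" by (simp add: prob_space)
    also have "\<dots> \<le> prob ({\<omega> \<in> space M. P n \<omega>} \<union> {\<omega> \<in> space M. Q n \<omega>})"
      using elim P Q by (intro finite_measure_mono) auto
    also have "\<dots> \<le> prob {\<omega> \<in> space M. P n \<omega>} + prob {\<omega> \<in> space M. Q n \<omega>}"
      by (rule measure_Un_le) (use P Q in auto)
    finally show ?case by simp
  qed
  show "(\<lambda>n. 1 - prob {\<omega> \<in> space M. Q n \<omega>}) \<longlonglongrightarrow> 1"
    using tendsto_diff[OF tendsto_const[of 1] lim] by simp
qed (auto intro: prob_le_1)

lemma (in prob_space) prob_disj_tendsto_0:
  assumes "\<And>n. {\<omega> \<in> space M. P n \<omega>} \<in> events" "\<And>n. {\<omega> \<in> space M. Q n \<omega>} \<in> events"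
    and "(\<lambda>n. prob {\<omega> \<in> space M. P n \<omega>}) \<longlonglongrightarrow> 0" "(\<lambda>n. prob {\<omega> \<in> space M. Q n \<omega>}) \<longlonglongrightarrow> 0"
  shows "(\<lambda>n. prob {\<omega> \<in> space M. P n \<omega> \<or> Q n \<omega>}) \<longlonglongrightarrow> 0"
proof (rule tendsto_sandwich[OF _ _ tendsto_const])
  show "\<forall>\<^sub>F n in sequentially. prob {\<omega> \<in> space M. P n \<omega> \<or> Q n \<omega>}
      \<le> prob {\<omega> \<in> space M. P n \<omega>} + prob {\<omega> \<in> space M. Q n \<omega>}"
  proof (intro always_eventually allI)
    fix n
    have "{\<omega> \<in> space M. P n \<omega> \<or> Q n \<omega>} = {\<omega> \<in> space M. P n \<omega>} \<union> {\<omega> \<in> space M. Q n \<omega>}" by auto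
    thus "prob {\<omega> \<in> space M. P n \<omega> \<or> Q n \<omega>}
      \<le> prob {\<omega> \<in> space M. P n \<omega>} + prob {\<omega> \<in> space M. Q n \<omega>}"
      by (simp only:) (rule measure_Un_le[OF assms(1,2)])
  qed
  show "(\<lambda>n. prob {\<omega> \<in> space M. P n \<omega>} + prob {\<omega> \<in> space M. Q n \<omega>}) \<longlonglongrightarrow> 0"
    using tendsto_add[OF assms(3,4)] by simp
qed auto

theorem theorem7p1:
  fixes M :: "'w measure"
    and \<epsilon> :: "nat \<Rightarrow> 'w \<Rightarrow> real"
    and \<sigma> :: real
    and p :: nat
    and \<beta> :: "real vec"
    and X :: "nat \<Rightarrow> real mat"
    and \<Sigma> :: "real mat"
    and y :: "nat \<Rightarrow> 'w \<Rightarrow> real vec"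
    and \<psi> :: "nat \<Rightarrow> 'w \<Rightarrow> nat set \<Rightarrow> real"
  assumes "prob_space M"
    and "prob_space.indep_vars M (\<lambda>_. borel) \<epsilon> UNIV"
    and "\<And>i. distr M borel (\<epsilon> i) = distr M borel (\<epsilon> 0)"
    and "\<And>i. integrable M (\<lambda>\<omega>. (\<epsilon> i \<omega>)\<^sup>2)"
    and "\<And>i. prob_space.expectation M (\<epsilon> i) = 0"
    and "\<And>i. prob_space.variance M (\<epsilon> i) = \<sigma>\<^sup>2"
    and "\<sigma> > 0"
    and "\<beta> \<in> carrier_vec p"
    and "\<And>n. X n \<in> carrier_mat n p"
    and "\<And>n \<omega>. y n \<omega> = response (X n) \<beta> (\<lambda>i. \<epsilon> i \<omega>)"
    and "\<And>n \<omega> A. \<psi> n \<omega> A = objective (X n) (y n \<omega>) A"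
    and "positive_definite p \<Sigma>"
    and "mat_tendsto p p (\<lambda>n. (1 / real n) \<cdot>\<^sub>m (transpose_mat (X n) * X n)) \<Sigma>"
  shows "(\<lambda>n. measure M {\<omega> \<in> space M.
            ereal (\<psi> n \<omega> (true_submodel \<beta>))
              < (INF A \<in> decision_space p - {true_submodel \<beta>}. ereal (\<psi> n \<omega> A))}) \<longlonglongrightarrow> 1"
proof -
  interpret iid_errors M \<epsilon> \<sigma>
    by (intro iid_errors.intro iid_errors_axioms.intro) (use assms in auto)
  note \<beta> = assms(8) and X = assms(9) and y = assms(10) and \<psi> = assms(11)
  let ?A\<^sub>0 = "true_submodel \<beta>"
  let ?B = "decision_space p - {?A\<^sub>0}"
  have finB: "finite ?B" by (simp add: decision_space_def)
  define e where "e = (\<lambda>n \<omega>. vec n (\<lambda>i. \<epsilon> i \<omega>))"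
  have e: "e n \<omega> \<in> carrier_vec n" for n \<omega> by (simp add: e_def)
  have y': "y n \<omega> = X n *\<^sub>v \<beta> + e n \<omega>" for n \<omega>
    using X[of n] by (simp add: y response_def e_def)
  have norm_e: "sq_euclidean_norm (e n \<omega>) = (\<Sum>i<n. (\<epsilon> i \<omega>)\<^sup>2)" for n \<omega>
    by (simp add: sq_euclidean_norm_def e_def)
  obtain l where l: "0 < l"
    "\<forall>\<^sub>F n in sequentially. \<forall>v \<in> carrier_vec p.
        (real n * l) * sq_euclidean_norm v \<le> sq_euclidean_norm (X n *\<^sub>v v)"
    using eventually_coercive[OF X assms(12,13)] by blast
  obtain c where c: "0 < c"
    "(\<lambda>n. prob {\<omega> \<in> space M. (\<Sum>i<n. (\<epsilon> i \<omega>)\<^sup>2) \<le> c * real n}) \<longlonglongrightarrow> 0"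
    using error_norm_lower by blast
  obtain \<delta> where \<delta>: "0 < \<delta>" "\<And>j. j < p \<Longrightarrow> \<beta> $ j \<noteq> 0 \<Longrightarrow> \<delta> \<le> (\<beta> $ j)\<^sup>2"
    using nonzero_coefficients_bounded_below by blast
  let ?s = "\<lambda>n. sqrt (ln (real n))"
  define bad where "bad = (\<lambda>n \<omega>. real n * ?s n \<le> sq_euclidean_norm (transpose_mat (X n) *\<^sub>v e n \<omega>)
      \<or> real n * ?s n \<le> (\<Sum>i<n. (\<epsilon> i \<omega>)\<^sup>2) \<or> (\<Sum>i<n. (\<epsilon> i \<omega>)\<^sup>2) \<le> c * real n)"
  have [measurable]: "(\<lambda>\<omega>. sq_euclidean_norm (transpose_mat (X n) *\<^sub>v e n \<omega>)) \<in> borel_measurable M" for n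
  proof -
    have "(\<lambda>\<omega>. (transpose_mat (X n) *\<^sub>v e n \<omega>) $ i) \<in> borel_measurable M" if "i < p" for i
      by (rule mult_mat_vec_measurable[where m = n]) (use X[of n] that in \<open>auto simp: e_def\<close>)
    thus ?thesis using X[of n] unfolding sq_euclidean_norm_def by auto
  qed
  have [measurable]: "(\<lambda>\<omega>. \<psi> n \<omega> A) \<in> borel_measurable M" for n A
    unfolding \<psi> y by (rule objective_measurable[OF X]) simp
  have bad_lim: "(\<lambda>n. prob {\<omega> \<in> space M. bad n \<omega>}) \<longlonglongrightarrow> 0"
    unfolding bad_def
  proof (rule prob_disj_tendsto_0[OF _ _ _ prob_disj_tendsto_0])
    show "(\<lambda>n. prob {\<omega> \<in> space M. real n * ?s n
        \<le> sq_euclidean_norm (transpose_mat (X n) *\<^sub>v e n \<omega>)}) \<longlonglongrightarrow> 0"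
      unfolding e_def by (rule score_negligible[OF X assms(13)])
  qed (measurable, fact error_norm_upper_negligible, fact c(2))
  have "\<forall>\<^sub>F n in sequentially. \<forall>\<omega>\<in>space M. (\<forall>A\<in>?B. \<psi> n \<omega> ?A\<^sub>0 < \<psi> n \<omega> A) \<or> bad n \<omega>"
    using l(2) eventually_over_margin[OF c(1) l(1), of "real p"]
      eventually_under_margin[OF \<delta>(1) l(1), of p] eventually_gt_at_top[of 0]
  proof eventually_elim
    case (elim n)
    show ?case
    proof (intro ballI disjCI)
      fix \<omega> A assume "\<not> bad n \<omega>" and A: "A \<in> ?B"
      hence bounds: "sq_euclidean_norm (transpose_mat (X n) *\<^sub>v e n \<omega>) \<le> real n * ?s n"
        "sq_euclidean_norm (e n \<omega>) \<le> real n * ?s n" "c * real n \<le> sq_euclidean_norm (e n \<omega>)"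
        by (auto simp: bad_def norm_e)
      show "\<psi> n \<omega> ?A\<^sub>0 < \<psi> n \<omega> A"
        unfolding \<psi> y'
        by (rule objective_less_objective[OF X _ refl \<beta> e l(1) _ \<delta>(2) bounds])
          (use elim A in \<open>auto simp: decision_space_def\<close>)
    qed
  qed
  hence "(\<lambda>n. prob {\<omega> \<in> space M. \<forall>A\<in>?B. \<psi> n \<omega> ?A\<^sub>0 < \<psi> n \<omega> A}) \<longlonglongrightarrow> 1"
  proof (rule prob_tendsto_1[OF _ _ bad_lim, rotated -1])
    show "{\<omega> \<in> space M. \<forall>A\<in>?B. \<psi> n \<omega> ?A\<^sub>0 < \<psi> n \<omega> A} \<in> events" for n
      using finB by (intro sets.sets_Collect_finite_All) measurable
    show "{\<omega> \<in> space M. bad n \<omega>} \<in> events" for n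
      unfolding bad_def by measurable
  qed
  thus ?thesis by (simp only: less_INF_ereal_iff[OF finB])
qed

end
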